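(* Let $d\ge 2$ and $l\ge 0$ be integers and $z_1,\ldots,z_d$ indeterminates. Then \[ \sum_{\mathcal{G}\in \mathrm{DSG}(d),\ |E(\mathcal{G})|=l} w(\mathcal{G})\;=\;\sum_{c\in C(l,d-1)} e_c(z_1,\ldots,z_d)\sum_{G\in \mathrm{VD}(c)}(-1)^{\#\mathrm{inv}(G)}. \]
   Context: $e_k(z_1,\ldots,z_d)$ is the $k$-th elementary symmetric polynomial ($e_0=1$, $e_k=0$ for $k>d$). $C(l,d-1)$ is the set of compositions $c=(c(1),\ldots,c(d-1))$ of $l$ into $d-1$ nonnegative integer parts, and $e_c(z_1,\ldots,z_d)=\prod_{i=1}^{d-1}e_{c(i)}(z_1,\ldots,z_d)$. $\mathrm{DSG}(d)$ is the set of directed graphs $\mathcal{G}$ on vertex set $\{1,\ldots,d\}$ with no parallel edges, no loops and no 2-cycles (so for each pair $i\ne j$ at most one of the edges $(i,j),(j,i)$ is present); $E(\mathcal{G})$ is its edge set, an edge $(i,j)$ goes from $i$ to $j$, and $w(\mathcal{G})=\prod_{(i,j)\in E(\mathcal{G})} z_i$. Points of $\mathbb{Z}^2$: for $1\le i\le d-1$, $\mathrm{source}(i)=(\lceil (i+1)/2\rceil,\,-\lfloor (i-1)/2\rfloor)$, and $\mathrm{sink}(i,r)=(i,\,d-i-r)$; for a point $\mathrm{sink}(i,r)$ its first coordinate is $i$. For $c\in C(l,d-1)$ let $B_{c,d}$ be the set of points $\mathrm{sink}(i,c(i))$, $1\le i\le d-1$. Let $E$ be the set of directed edges $(i,j)\to(i,j+1)$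 and $(i,j)\to(i+1,j+1)$ on $\mathbb{Z}^2$. $\mathrm{VD}(c)$ is the set of directed graphs $G$ consisting of $d-1$ paths $G_1,\ldots,G_{d-1}$ such that $G_l$ begins at $\mathrm{source}(l)$ and either (a) $G_l$ is a directed path all of whose edges lie in $E$ and which ends at a vertex $\mathrm{sink}(G_l)\in B_{c,d}$, or (b) $l=2i$ for some integer $i$ with $c(i)=d$, and $G_l$ consists of a single directed edge from $\mathrm{source}(l)$ to $\mathrm{sink}(G_l)=\mathrm{sink}(i,d)$; and the paths satisfying (a) are pairwise vertex-disjoint. $\#\mathrm{inv}(G)$ is the number of inversions of the sequence of first coordinates of $\mathrm{sink}(G_1),\ldots,\mathrm{sink}(G_{d-1})$. *)

theory Defs
  imports Complex_Main "HOL-Library.FuncSet" "HOL-Library.Poly_Mapping"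
begin

type_synonym 'a mpoly = "(nat \<Rightarrow>\<^sub>0 nat) \<Rightarrow>\<^sub>0 'a"

definition indet :: "nat \<Rightarrow> 'a::comm_ring_1 mpoly" where
  "indet i = Poly_Mapping.single (Poly_Mapping.single i 1) 1"

definition elem_sym :: "nat \<Rightarrow> nat \<Rightarrow> (nat \<Rightarrow> 'a::comm_ring_1) \<Rightarrow> 'a" where
  "elem_sym d k z = (\<Sum>S | S \<subseteq> {1..d} \<and> card S = k. \<Prod>i\<in>S. z i)"

definition compositions :: "nat \<Rightarrow> nat \<Rightarrow> (nat \<Rightarrow> nat) set" where
  "compositions l n = {c \<in> {1..n} \<rightarrow>\<^sub>E UNIV. (\<Sum>i=1..n. c i) = l}"

definition elem_sym_comp :: "nat \<Rightarrow> (nat \<Rightarrow> nat) \<Rightarrow> (nat \<Rightarrow> 'a::comm_ring_1) \<Rightarrow> 'a" where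
  "elem_sym_comp d c z = (\<Prod>i=1..d-1. elem_sym d (c i) z)"

text \<open>A directed graph without parallel edges on the vertices \<open>1, \<dots>, d\<close> is given by its edge set.\<close>

definition DSG :: "nat \<Rightarrow> (nat \<times> nat) set set" where
  "DSG d = {E. E \<subseteq> {1..d} \<times> {1..d} \<and> (\<forall>i. (i, i) \<notin> E) \<and>
               (\<forall>i j. (i, j) \<in> E \<longrightarrow> (j, i) \<notin> E)}"

definition weight :: "(nat \<Rightarrow> 'a::comm_ring_1) \<Rightarrow> (nat \<times> nat) set \<Rightarrow> 'a" where
  "weight z E = (\<Prod>(i, j)\<in>E. z i)"

type_synonym point = "int \<times> int"

definition source :: "nat \<Rightarrow> point" where
  "source i = (\<lceil>(real i + 1) / 2\<rceil>, - \<lfloor>(real i - 1) / 2\<rfloor>)"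

definition sink :: "nat \<Rightarrow> nat \<Rightarrow> nat \<Rightarrow> point" where
  "sink d i r = (int i, int d - int i - int r)"

definition sinks :: "nat \<Rightarrow> (nat \<Rightarrow> nat) \<Rightarrow> point set" where
  "sinks d c = {sink d i (c i) | i. i \<in> {1..d-1}}"

definition lattice_edge :: "point \<Rightarrow> point \<Rightarrow> bool" where
  "lattice_edge p q \<longleftrightarrow> q = (fst p, snd p + 1) \<or> q = (fst p + 1, snd p + 1)"

text \<open>
  A path is the nonempty list of its vertices in order; a single vertex is the path
  of length 0. A lattice path visits no vertex twice, since the second coordinate
  increases along every edge.
\<close>

definition lattice_path :: "nat \<Rightarrow> (nat \<Rightarrow> nat) \<Rightarrow> nat \<Rightarrow> point list \<Rightarrow> bool" where
  "lattice_path d c l p \<longleftrightarrow>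
     p \<noteq> [] \<and> hd p = source l \<and> successively lattice_edge p \<and> last p \<in> sinks d c"

definition special_path :: "nat \<Rightarrow> (nat \<Rightarrow> nat) \<Rightarrow> nat \<Rightarrow> point list \<Rightarrow> bool" where
  "special_path d c l p \<longleftrightarrow>
     (\<exists>i\<in>{1..d-1}. l = 2 * i \<and> c i = d \<and> p = [source l, sink d i d])"

text \<open>
  An element of \<open>VD d c\<close> is the family of its paths. The graph formed by the paths
  determines the family: the edges outside the lattice are exactly the special paths, and
  the remaining paths are vertex-disjoint and have prescribed starting points.
\<close>

definition VD :: "nat \<Rightarrow> (nat \<Rightarrow> nat) \<Rightarrow> (nat \<Rightarrow> point list) set" where
  "VD d c = {G \<in> extensional {1..d-1}.
     (\<forall>l\<in>{1..d-1}. lattice_path d c l (G l) \<or> special_path d c l (G l)) \<and>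
     (\<forall>l\<in>{1..d-1}. \<forall>m\<in>{1..d-1}. l \<noteq> m \<longrightarrow>
        lattice_path d c l (G l) \<longrightarrow> lattice_path d c m (G m) \<longrightarrow>
        set (G l) \<inter> set (G m) = {})}"

definition num_inv :: "nat \<Rightarrow> (nat \<Rightarrow> point list) \<Rightarrow> nat" where
  "num_inv d G = card {(a, b). a \<in> {1..d-1} \<and> b \<in> {1..d-1} \<and> a < b \<and>
                               fst (last (G a)) > fst (last (G b))}"

end

theory Submission
  imports Defs "Jordan_Normal_Form.Determinant"
begin

text \<open>
  Let \<open>f(x) = (x + z\<^sub>1) \<cdots> (x + z\<^sub>d)\<close> and write \<open>f = P(y) + x Q(y)\<close> with \<open>y = x\<^sup>2 - x\<close>. The
  \<open>d - 1\<close> polynomials \<open>Q, P, yQ, yP, y\<^sup>2Q, \<dots>\<close> have degree at most \<open>d - 2\<close>, and the determinant of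
  their coefficient matrix (a row permutation of the Sylvester matrix of \<open>P\<close> and \<open>Q\<close>) is
  \<open>\<Prod>\<^bsub>i<j\<^esub> (1 + z\<^sub>i + z\<^sub>j)\<close>: multiplying \<open>f\<close> by \<open>x + w\<close> multiplies it by \<open>f(1 + w)\<close>, as one sees by
  elementary row operations followed by synthetic division by \<open>y - w(w + 1)\<close>.

  The product is the generating function of \<open>DSG d\<close>. On the other hand, expanding \<open>f\<close> in powers
  of \<open>x\<close> shows that the matrix entries are the sums \<open>\<Sum>\<^sub>r e\<^sub>r M(r)\<close>, where \<open>M(r)\<close> counts the paths
  from a source to \<open>sink(i, r)\<close>; the special edge accounts for the constant \<open>x\<^sup>0 = 1\<close>. By
  multilinearity and the Lindstroem-Gessel-Viennot involution, the determinant is the right-hand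
  side.
\<close>

section \<open>The interleaved Sylvester determinant\<close>

text \<open>
  \<open>stair z d j k\<close> is the coefficient of \<open>y\<^sup>k\<close> in entry \<open>j\<close> (counted from 0) of \<open>Q, P, yQ, yP, \<dots>\<close>;
  the recursion is \<open>(x + w)(P + xQ) = (wP + yQ) + x(P + (w + 1)Q)\<close>.
\<close>

fun stair :: "(nat \<Rightarrow> 'a::comm_ring_1) \<Rightarrow> nat \<Rightarrow> nat \<Rightarrow> nat \<Rightarrow> 'a" where
  "stair z 0 j k = (if j = 2 * k + 1 then 1 else 0)"
| "stair z (Suc d) j k =
     stair z d (Suc j) k + (z (Suc d) + (if even j then 1 else 0)) * stair z d j k"

text \<open>Entry \<open>j + 2\<close> of \<open>Q, P, yQ, yP, ...\<close> is \<open>y\<close> times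
  entry \<open>j\<close>, so coefficients move up by one.\<close>

lemma stair_shift: "stair z d (Suc (Suc j)) (Suc k) = stair z d j k"
  by (induction d arbitrary: j k) auto

lemma stair_shift_0: "stair z d (Suc (Suc j)) 0 = 0"
  by (induction d arbitrary: j) auto

lemma stair_eq_0: "j + d \<le> 2 * k \<Longrightarrow> stair z d j k = 0"
  by (induction d arbitrary: j k) auto

text \<open>The bound forces \<open>stair z d j N = 0\<close>, so truncating at \<open>y ^ N\<close>
  loses nothing.\<close>

lemma stair_sum_shift:
  assumes "j + d \<le> 2 * N"
  shows "(\<Sum>k\<le>N. stair z d (Suc (Suc j)) k * y ^ k) = y * (\<Sum>k\<le>N. stair z d j k * y ^ k)"
proof (cases N)
  case 0
  then show ?thesis using assms by (simp add: stair_shift_0 stair_eq_0)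
next
  case (Suc M)
  have "(\<Sum>k\<le>N. stair z d (Suc (Suc j)) k * y ^ k) = (\<Sum>k\<le>M. stair z d j k * y ^ Suc k)"
    unfolding Suc sum.atMost_Suc_shift by (simp add: stair_shift_0 stair_shift)
  also have "\<dots> = y * (\<Sum>k\<le>M. stair z d j k * y ^ k)"
    by (simp add: sum_distrib_left algebra_simps)
  also have "(\<Sum>k\<le>M. stair z d j k * y ^ k) = (\<Sum>k\<le>N. stair z d j k * y ^ k)"
    using assms by (simp add: Suc stair_eq_0)
  finally show ?thesis .
qed

text \<open>At \<open>x = w + 1\<close> the value of \<open>y = x^2 - x\<close> is
  \<open>w * (w + 1)\<close>, so the left side is \<open>P + x Q = f(w + 1)\<close>.\<close>

lemma stair_eval:
  assumes "d \<le> 2 * N + 1"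
  shows "(\<Sum>k\<le>N. stair z d 1 k * (w * (w + 1)) ^ k) +
      (w + 1) * (\<Sum>k\<le>N. stair z d 0 k * (w * (w + 1)) ^ k) = (\<Prod>i=1..d. 1 + w + z i)"
  using assms
proof (induction d)
  case 0
  have "(\<Sum>k\<le>N. stair z 0 1 k * (w * (w + 1)) ^ k) = (\<Sum>k\<le>N. if k = 0 then 1 else 0)"
    by (intro sum.cong) auto
  then show ?case by simp
next
  case (Suc d)
  define y where "y = w * (w + 1)"
  define F where "F j = (\<Sum>k\<le>N. stair z d j k * y ^ k)" for j
  have step: "(\<Sum>k\<le>N. stair z (Suc d) j k * y ^ k) =
      F (Suc j) + (z (Suc d) + (if even j then 1 else 0)) * F j" for j
    by (simp add: F_def algebra_simps sum.distrib sum_distrib_left)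
  have "F 2 = y * F 0"
    using stair_sum_shift[of 0 d N z y] Suc.prems by (simp add: F_def numeral_2_eq_2)
  moreover have "F 1 + (w + 1) * F 0 = (\<Prod>i=1..d. 1 + w + z i)"
    using Suc by (simp add: F_def y_def)
  \<comment> \<open>This is multiplication of \<open>f\<close> by \<open>x + z (Suc d)\<close> at
    \<open>x = w + 1\<close>, up to \<open>F 2 - y * F 0\<close>, which is 0 by the shift.\<close>
  moreover have "(F 2 + z (Suc d) * F 1) + (w + 1) * (F 1 + (z (Suc d) + 1) * F 0) =
      (F 2 - y * F 0) + (1 + w + z (Suc d)) * (F 1 + (w + 1) * F 0)"
    by (simp add: y_def algebra_simps)
  ultimately show ?case
    unfolding y_def[symmetric] step by (simp add: numeral_2_eq_2 mult.commute)
qed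

section \<open>The determinant by row and column operations\<close>

definition stair_mat :: "(nat \<Rightarrow> 'a::comm_ring_1) \<Rightarrow> nat \<Rightarrow> 'a mat" where
  "stair_mat z n = mat n n (\<lambda>(j, k). stair z (Suc n) j k)"

lemma stair_mat_carrier [simp]: "stair_mat z n \<in> carrier_mat n n"
  by (simp add: stair_mat_def)

text \<open>Entry \<open>j + 1\<close> of the shorter product cancels, and the two factors left over
  are \<open>z (Suc d)\<close> and \<open>z (Suc d) + 1\<close>, in an order given by the parity of
  \<open>j\<close>.\<close>

lemma stair_row_operation:
  "stair z (Suc d) (Suc j) k - (z (Suc d) + (if even j then 0 else 1)) * stair z (Suc d) j k =
   stair z d (Suc (Suc j)) k - z (Suc d) * (z (Suc d) + 1) * stair z d j k"
  by (cases "even j") (simp_all add: algebra_simps)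

lemma geometric_telescope:
  fixes s :: "nat \<Rightarrow> 'a::comm_ring_1"
  assumes "j \<le> m"
  shows "(\<Sum>k=j..<m. (s k - y * s (Suc k)) * y ^ (k - j)) = s j - s m * y ^ (m - j)"
  using assms by (induction m rule: dec_induct) (simp_all add: algebra_simps Suc_diff_le)

text \<open>Synthetic division: the quotient of \<open>(t - y) s(t)\<close> by \<open>t - y\<close> has the coefficients of \<open>s\<close>.\<close>

lemma stair_quotient:
  assumes "j + d \<le> 2 * n" "i \<le> n"
  shows "(\<Sum>k=i..n. (stair z d (Suc (Suc j)) k - y * stair z d j k) * y ^ (k - i)) =
    stair z d (Suc (Suc j)) i"
proof -
  have "(\<Sum>k=i..<Suc n. (stair z d (Suc (Suc j)) k - y * stair z d j k) * y ^ (k - i)) =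
      stair z d (Suc (Suc j)) i - stair z d (Suc (Suc j)) (Suc n) * y ^ (Suc n - i)"
    using geometric_telescope[of i "Suc n" "stair z d (Suc (Suc j))" y] assms
    by (simp add: stair_shift)
  then show ?thesis
    using assms by (simp add: stair_shift stair_eq_0 atLeastLessThanSuc_atLeastAtMost)
qed

lemma index_mult_mat_sum:
  assumes "A \<in> carrier_mat n n" "B \<in> carrier_mat n n" "i < n" "j < n"
  shows "(A * B) $$ (i, j) = (\<Sum>m=0..<n. A $$ (i, m) * B $$ (m, j))"
  using assms by (auto simp: scalar_prod_def intro!: sum.cong)

text \<open>The row operations \<open>L\<close> turn each row but the first into a row for one
  factor less, multiplied by \<open>t - y\<close> with \<open>y = w * (w + 1)\<close>. The column
  operations \<open>W\<close> put the value at \<open>t = y\<close> into column 0 and the quotient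
  by \<open>t - y\<close> into the others. Both matrices are unitriangular.\<close>

lemma det_stair_mat_Suc:
  "det (stair_mat z (Suc n)) =
   (\<Prod>i=1..Suc n. 1 + z (Suc (Suc n)) + z i) * det (stair_mat z n)"
proof -
  define d where "d = Suc n"
  define w where "w = z (Suc d)"
  define y where "y = w * (w + 1)"
  define R where "R = stair_mat z d"
  define L where "L = mat d d (\<lambda>(i, j). if i = j then 1
    else if i = Suc j then - (w + (if even j then 0 else 1)) else 0)"
  define W where "W = mat d d (\<lambda>(k, j). if j \<le> k then y ^ (k - j) else 0)"
  have carr [simp]: "R \<in> carrier_mat d d" "L \<in> carrier_mat d d" "W \<in> carrier_mat d d"
    by (simp_all add: R_def L_def W_def stair_mat_def)
  have "det L = 1"
    by (subst det_lower_triangular[of d])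
       (auto simp: L_def prod_list_diag_prod intro!: prod.neutral)
  have "det W = 1"
    by (subst det_lower_triangular[of d])
       (auto simp: W_def prod_list_diag_prod intro!: prod.neutral)
  have LR0: "(L * R) $$ (0, k) = stair z (Suc d) 0 k" if "k < d" for k
  proof -
    have "(L * R) $$ (0, k) = (\<Sum>m=0..<d. (if m = 0 then stair z (Suc d) 0 k else 0))"
      using that by (subst index_mult_mat_sum[of _ d])
         (auto simp: d_def R_def L_def stair_mat_def simp del: stair.simps sum.op_ivl_Suc sum.delta sum.delta'
          intro!: sum.cong)
    then show ?thesis by (simp add: d_def)
  qed
  have LR: "(L * R) $$ (Suc i, k) = stair z d (Suc (Suc i)) k - y * stair z d i k"
    if "k < d" "Suc i < d" for i k
  proof -
    have "(L * R) $$ (Suc i, k) = (\<Sum>m=0..<d. (if m = Suc i then stair z (Suc d) (Suc i) k else 0)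
        + (if m = i then - (w + (if even i then 0 else 1)) * stair z (Suc d) i k else 0))"
      using that by (subst index_mult_mat_sum[of _ d])
         (auto simp: R_def L_def stair_mat_def simp del: stair.simps sum.op_ivl_Suc sum.delta sum.delta'
          intro!: sum.cong)
    also have "\<dots> = stair z (Suc d) (Suc i) k - (w + (if even i then 0 else 1)) * stair z (Suc d) i k"
      using that by (simp add: sum.distrib algebra_simps del: stair.simps)
    also have "\<dots> = stair z d (Suc (Suc i)) k - y * stair z d i k"
      unfolding w_def y_def by (rule stair_row_operation)
    finally show ?thesis .
  qed
  have mult_W: "(L * R * W) $$ (i, j) = (\<Sum>k=j..n. (L * R) $$ (i, k) * y ^ (k - j))"
    if "i < d" "j < d" for i j
  proof -
    have "(L * R * W) $$ (i, j) =
        (\<Sum>k=0..<d. (L * R) $$ (i, k) * (if j \<le> k then y ^ (k - j) else 0))"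
      using that by (subst index_mult_mat_sum[of _ d])
         (auto simp: W_def intro!: sum.cong mult_carrier_mat[of _ d d])
    also have "\<dots> = (\<Sum>k=j..n. (L * R) $$ (i, k) * y ^ (k - j))"
      by (rule sum.mono_neutral_cong_right) (auto simp: d_def)
    finally show ?thesis .
  qed
  have corner: "(L * R * W) $$ (0, 0) = (\<Prod>i=1..d. 1 + w + z i)"
  proof -
    have "(L * R * W) $$ (0, 0) = (\<Sum>k\<le>n. stair z (Suc d) 0 k * y ^ k)"
      by (subst mult_W) (auto simp: d_def LR0[unfolded d_def] atMost_atLeast0 simp del: stair.simps
          intro!: sum.cong)
    \<comment> \<open>One recursion step at \<open>j = 0\<close>, where the parity term is 1, gives
      the combination evaluated by \<open>stair_eval\<close>.\<close>
    also have "\<dots> = (\<Sum>k\<le>n. stair z d 1 k * y ^ k) + (w + 1) * (\<Sum>k\<le>n. stair z d 0 k * y ^ k)"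
      by (simp add: w_def algebra_simps sum.distrib sum_distrib_left)
    also have "\<dots> = (\<Prod>i=1..d. 1 + w + z i)"
      unfolding y_def by (rule stair_eval) (simp add: d_def)
    finally show ?thesis .
  qed
  have block: "(L * R * W) $$ (Suc i, j) = stair z d (Suc (Suc i)) j" if "Suc i < d" "j < d" for i j
  proof -
    have "(L * R * W) $$ (Suc i, j) =
        (\<Sum>k=j..n. (stair z d (Suc (Suc i)) k - y * stair z d i k) * y ^ (k - j))"
      using that by (subst mult_W) (auto simp: LR d_def intro!: sum.cong)
    also have "\<dots> = stair z d (Suc (Suc i)) j"
      using that by (intro stair_quotient) (auto simp: d_def)
    finally show ?thesis .
  qed
  \<comment> \<open>Below the corner, column 0 vanishes by \<open>stair_shift_0\<close>, and the
    remaining block is \<open>stair_mat z n\<close> by \<open>stair_shift\<close>.\<close>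
  have "L * R * W = four_block_mat (mat 1 1 (\<lambda>_. \<Prod>i=1..d. 1 + w + z i))
      (mat 1 n (\<lambda>(i, j). (L * R * W) $$ (0, Suc j))) (0\<^sub>m n 1) (stair_mat z n)" (is "_ = ?B")
  proof (rule eq_matI)
    fix i j assume ij: "i < dim_row ?B" "j < dim_col ?B"
    show "(L * R * W) $$ (i, j) = ?B $$ (i, j)"
    proof (cases i)
      case 0
      moreover have "Suc m < d \<longleftrightarrow> m < n" for m by (simp add: d_def)
      ultimately show ?thesis using ij corner
        by (cases j) (auto simp: stair_mat_def d_def[symmetric])
    next
      case (Suc i')
      then show ?thesis using ij
        by (cases j) (auto simp: block[unfolded d_def] d_def stair_mat_def stair_shift stair_shift_0
            simp del: stair.simps)
    qed
  qed (use carr in \<open>auto simp: d_def stair_mat_def\<close>)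
  then have "det (L * R * W) = det ?B" by (rule arg_cong)
  also have "\<dots> = (\<Prod>i=1..d. 1 + w + z i) * det (stair_mat z n)"
    by (subst det_four_block_mat_lower_left_zero_col[where n = n]) (auto simp: det_single)
  finally have "det (L * R * W) = (\<Prod>i=1..d. 1 + w + z i) * det (stair_mat z n)" .
  moreover have "det (L * R * W) = det R"
    using \<open>det L = 1\<close> \<open>det W = 1\<close>
    by (simp add: det_mult[of _ d] mult_carrier_mat[of _ d d])
  ultimately show ?thesis by (simp add: R_def d_def w_def)
qed

lemma det_stair_mat: "det (stair_mat z n) = (\<Prod>j=1..Suc n. \<Prod>i=1..<j. 1 + z j + z i)"
proof (induction n)
  case 0
  then show ?case by (simp add: stair_mat_def)
next
  case (Suc n)
  then show ?case
    by (simp add: det_stair_mat_Suc mult.commute flip: atLeastLessThanSuc_atLeastAtMost)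
qed

section \<open>Signs and inversions\<close>

definition inversions :: "nat set \<Rightarrow> (nat \<Rightarrow> nat) \<Rightarrow> (nat \<times> nat) set" where
  "inversions S p = {(a, b). a \<in> S \<and> b \<in> S \<and> a < b \<and> p b < p a}"

text \<open>In this form the sign can be reindexed and split pair by pair.\<close>

lemma minus_one_power_inversions:
  assumes "finite S"
  shows "(- 1 :: int) ^ card (inversions S p) =
    (\<Prod>(a, b) | a \<in> S \<and> b \<in> S \<and> a < b. if p b < p a then - 1 else 1)"
proof -
  let ?P = "{(a, b). a \<in> S \<and> b \<in> S \<and> a < b}"
  have "finite ?P"
    by (rule finite_subset[of _ "S \<times> S"]) (use assms in auto)
  then have "(\<Prod>(a, b)\<in>?P. if p b < p a then - 1 else 1 :: int) = (\<Prod>x\<in>inversions S p. - 1)"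
    by (intro prod.mono_neutral_cong_right) (auto simp: inversions_def split: if_splits)
  then show ?thesis by simp
qed

text \<open>\<open>g\<close> records whether \<open>q\<close> reverses an unordered pair, so its
  product over all pairs does not change when \<open>p\<close> moves the pairs.\<close>

lemma minus_one_power_inversions_comp:
  assumes S: "finite S" and p: "p permutes S" and q: "q permutes S"
  shows "(- 1 :: int) ^ card (inversions S (q \<circ> p)) =
    (- 1) ^ card (inversions S q) * (- 1) ^ card (inversions S p)"
proof -
  let ?P = "{(a, b). a \<in> S \<and> b \<in> S \<and> a < b}"
  define g :: "nat \<Rightarrow> nat \<Rightarrow> int" where
    "g u v = (if q v < q u then - 1 else 1) * (if v < u then - 1 else 1)" for u v
  have g_sym: "g v u = g u v" if "u < v" for u v
  proof -
    have "q u \<noteq> q v" using that permutes_inj[OF q] by (auto dest: injD)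
    then show ?thesis using that by (auto simp: g_def)
  qed
  have [simp]: "p a = p b \<longleftrightarrow> a = b" "Hilbert_Choice.inv p a = Hilbert_Choice.inv p b \<longleftrightarrow> a = b" for a b
    using permutes_inj[OF p] permutes_inj[OF permutes_inv[OF p]] by (auto dest: injD)
  have [simp]: "p a \<in> S \<longleftrightarrow> a \<in> S" "Hilbert_Choice.inv p a \<in> S \<longleftrightarrow> a \<in> S" for a
    using p permutes_inv[OF p] by (auto simp: permutes_in_image)
  have [simp]: "p (Hilbert_Choice.inv p a) = a" "Hilbert_Choice.inv p (p a) = a" for a
    using permutes_inverses[OF p] by auto
  \<comment> \<open>\<open>srt r\<close> sends a pair to its image under \<open>r\<close>, listed in
    increasing order.\<close>
  define srt where "srt r = (\<lambda>(a, b). if r a < r b then (r a, r b) else (r b, r a))"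
    for r :: "nat \<Rightarrow> nat"
  have "(\<Prod>(a, b)\<in>?P. g (p a) (p b)) = (\<Prod>(a, b)\<in>?P. g a b)"
    by (rule prod.reindex_bij_witness[where i = "srt (Hilbert_Choice.inv p)" and j = "srt p"])
       (auto simp: srt_def not_less le_less split: if_splits intro: g_sym g_sym[symmetric])
  also have "\<dots> = (- 1) ^ card (inversions S q)"
    unfolding minus_one_power_inversions[OF S] by (rule prod.cong) (auto simp: g_def)
  finally have "(- 1) ^ card (inversions S q) = (\<Prod>(a, b)\<in>?P. g (p a) (p b))" ..
  then show ?thesis
    unfolding minus_one_power_inversions[OF S, of "q \<circ> p"] minus_one_power_inversions[OF S, of p]
    by (auto simp: g_def simp flip: prod.distrib intro!: prod.cong)
qed

text \<open>Besides \<open>(x, y)\<close>, each \<open>k\<close> strictly between contributes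
  exactly \<open>(x, k)\<close> and \<open>(k, y)\<close>, so the number of inversions is
  odd.\<close>

lemma minus_one_power_inversions_transpose:
  assumes "finite S" "x \<in> S" "y \<in> S" "x < y"
  shows "(- 1 :: int) ^ card (inversions S (transpose x y)) = - 1"
proof -
  let ?M = "{k \<in> S. x < k \<and> k < y}"
  have "inversions S (transpose x y) = insert (x, y) (Pair x ` ?M \<union> (\<lambda>k. (k, y)) ` ?M)"
    using assms by (auto simp: inversions_def transpose_def split: if_splits)
  moreover have "card (Pair x ` ?M \<union> (\<lambda>k. (k, y)) ` ?M) = card ?M + card ?M"
    using assms by (subst card_Un_disjoint) (auto simp: card_image inj_on_def)
  moreover have "(x, y) \<notin> Pair x ` ?M \<union> (\<lambda>k. (k, y)) ` ?M" by auto
  ultimately have "card (inversions S (transpose x y)) = Suc (2 * card ?M)"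
    using assms by (simp del: Un_iff)
  then show ?thesis by simp
qed

text \<open>Both sides are multiplicative and equal -1 on transpositions. This links the sign in the
  determinant to \<open>num_inv\<close>.\<close>

lemma sign_eq_inversions:
  assumes "p permutes S" "finite S"
  shows "sign p = (- 1) ^ card (inversions S p)"
  using assms
proof (induction p rule: permutes_induct)
  case id
  have "inversions S (\<lambda>a. a) = {}" by (auto simp: inversions_def)
  then show ?case by (simp add: id_def)
next
  case (swap a b p)
  have "sign (transpose a b \<circ> p) = - sign p"
    using swap permutes_imp_permutation[OF assms(2)]
    by (subst sign_compose) (auto simp: sign_swap_id permutation_swap_id)
  moreover have "(- 1 :: int) ^ card (inversions S (transpose a b)) = - 1"
    using swap minus_one_power_inversions_transpose[of S a b]
      minus_one_power_inversions_transpose[of S b a] assms(2)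
    by (cases a b rule: linorder_cases) (auto simp: transpose_commute)
  ultimately show ?case
    using swap(5)
      minus_one_power_inversions_comp[OF assms(2) swap(4) permutes_swap_id[OF swap(1,2)]]
    by (simp add: comp_def)
qed

section \<open>Lattice paths\<close>

definition lattice_paths :: "point \<Rightarrow> point \<Rightarrow> point list set" where
  "lattice_paths p q = {xs. xs \<noteq> [] \<and> hd xs = p \<and> successively lattice_edge xs \<and> last xs = q}"

text \<open>The cut is by height, not by list position: heights increase strictly along a path, so
  at a common vertex this is the usual splice, and exchanging twice is a computation with
  filters.\<close>

definition swap_tail :: "int \<Rightarrow> point list \<Rightarrow> point list \<Rightarrow> point list" where
  "swap_tail y xs ys = filter (\<lambda>u. snd u < y) xs @ filter (\<lambda>u. y \<le> snd u) ys"

lemma lattice_path_sorted: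
  assumes "successively lattice_edge xs"
  shows "sorted_wrt (\<lambda>u v. fst u \<le> fst v \<and> snd u < snd v) xs"
proof -
  have "successively (\<lambda>u v. fst u \<le> fst v \<and> snd u < snd v) xs"
    using assms by (rule successively_mono) (auto simp: lattice_edge_def)
  then show ?thesis
    by (subst (asm) successively_conv_sorted_wrt) (auto intro: transpI)
qed

lemma lattice_paths_mono:
  assumes "xs \<in> lattice_paths p q"
  shows "fst p \<le> fst q" "snd p \<le> snd q"
proof -
  from assms obtain ys where xs: "xs = p # ys"
    by (cases xs) (auto simp: lattice_paths_def)
  with assms have "sorted_wrt (\<lambda>u v. fst u \<le> fst v \<and> snd u < snd v) (p # ys)" "last (p # ys) = q"
    by (auto simp: lattice_paths_def lattice_path_sorted simp del: sorted_wrt.simps)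
  then show "fst p \<le> fst q" "snd p \<le> snd q"
    by (auto split: if_splits dest!: last_in_set)+
qed

lemma swap_tail_split:
  assumes "successively lattice_edge (us @ v # ws)" "successively lattice_edge (us' @ v # ws')"
  shows "swap_tail (snd v) (us @ v # ws) (us' @ v # ws') = us @ v # ws'"
proof -
  have "\<forall>u\<in>set us. snd u < snd v" "\<forall>u\<in>set ws. snd v < snd u"
    "\<forall>u\<in>set us'. snd u < snd v" "\<forall>u\<in>set ws'. snd v < snd u"
    using assms[THEN lattice_path_sorted] by (auto simp: sorted_wrt_append)
  then have "filter (\<lambda>u. snd u < snd v) us = us" "filter (\<lambda>u. snd u < snd v) ws = []"
    "filter (\<lambda>u. snd v \<le> snd u) us' = []" "filter (\<lambda>u. snd v \<le> snd u) ws' = ws'"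
    by (force simp: filter_id_conv filter_empty_conv)+
  then show ?thesis by (simp add: swap_tail_def)
qed

lemma swap_tail_in_lattice_paths:
  assumes "xs \<in> lattice_paths p q" "ys \<in> lattice_paths p' q'" "v \<in> set xs" "v \<in> set ys"
  shows "swap_tail (snd v) xs ys \<in> lattice_paths p q'"
proof -
  obtain us ws us' ws' where split: "xs = us @ v # ws" "ys = us' @ v # ws'"
    using assms by (meson split_list)
  then have "swap_tail (snd v) xs ys = us @ v # ws'"
    using assms by (simp add: swap_tail_split lattice_paths_def)
  then show ?thesis
    using assms split
    by (auto simp: lattice_paths_def successively_append_iff successively_Cons hd_append split: if_splits)
qed

lemma swap_tail_self:
  assumes "successively lattice_edge xs"
  shows "swap_tail y xs xs = xs"
proof -
  have "sorted_wrt (\<lambda>u v. snd u < snd v) xs"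
    using lattice_path_sorted[OF assms] by (rule sorted_wrt_mono_rel[rotated]) auto
  then show ?thesis
  proof (induction xs)
    case (Cons u xs)
    show ?case
    proof (cases "snd u < y")
      case True
      then show ?thesis using Cons by (simp add: swap_tail_def)
    next
      case False
      then have "filter (\<lambda>v. snd v < y) xs = []" "filter (\<lambda>v. y \<le> snd v) xs = xs"
        using Cons.prems by (force simp: filter_empty_conv filter_id_conv)+
      then show ?thesis using False by (simp add: swap_tail_def)
    qed
  qed (simp add: swap_tail_def)
qed

text \<open>The part above the cut returns to its own path; for a lattice path
  \<open>swap_tail_self\<close> then gives \<open>xs\<close>.\<close>

lemma swap_tail_twice:
  "swap_tail y (swap_tail y xs ys) (swap_tail y ys xs) = swap_tail y xs xs"
proof -
  have "filter (\<lambda>u. snd u < y) (filter (\<lambda>u. y \<le> snd u) zs) = []"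
    "filter (\<lambda>u. y \<le> snd u) (filter (\<lambda>u. snd u < y) zs) = []" for zs :: "point list"
    by (auto simp: filter_empty_conv)
  then show ?thesis by (simp add: swap_tail_def del: filter_filter)
qed

lemma set_swap_tail: "u \<in> set (swap_tail y xs ys) \<longleftrightarrow> u \<in> set (if snd u < y then xs else ys)"
  by (auto simp: swap_tail_def)

section \<open>Coordinates of the sources and the number of lattice paths\<close>

lemma source_odd: "source (Suc (2 * m)) = (int m + 1, - int m)"
proof -
  have "\<lceil>(real (Suc (2 * m)) + 1) / 2\<rceil> = int m + 1" "\<lfloor>(real (Suc (2 * m)) - 1) / 2\<rfloor> = int m"
    by (auto intro!: ceiling_unique floor_unique)
  then show ?thesis by (simp add: source_def)
qed

lemma source_even: "source (Suc (Suc (2 * m))) = (int m + 2, - int m)"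
proof -
  have "\<lceil>(real (Suc (Suc (2 * m))) + 1) / 2\<rceil> = int m + 2"
    "\<lfloor>(real (Suc (Suc (2 * m))) - 1) / 2\<rfloor> = int m"
    by (auto intro!: ceiling_unique floor_unique)
  then show ?thesis by (simp add: source_def)
qed

definition lattice_count :: "int \<Rightarrow> int \<Rightarrow> nat" where
  "lattice_count n h = (if n < 0 \<or> h < 0 then 0 else nat h choose nat n)"

text \<open>Pascal's rule; the first summand accounts for the path of length 0.\<close>

lemma lattice_count_rec:
  assumes "0 \<le> h"
  shows "lattice_count n h =
    (if n = 0 \<and> h = 0 then 1 else 0) + lattice_count n (h - 1) + lattice_count (n - 1) (h - 1)"
proof (cases "0 < n \<and> 0 < h")
  case True
  then have "n = int (Suc (nat (n - 1)))" "h = int (Suc (nat (h - 1)))" by auto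
  then obtain a b where "n = int (Suc a)" "h = int (Suc b)" by blast
  then show ?thesis by (simp add: lattice_count_def nat_add_distrib)
next
  case False
  then show ?thesis using assms by (auto simp: lattice_count_def)
qed

lemma lattice_paths_rec:
  "lattice_paths p q = (if p = q then {[p]} else {}) \<union>
     (Cons p ` lattice_paths (fst p, snd p + 1) q \<union> Cons p ` lattice_paths (fst p + 1, snd p + 1) q)"
proof (intro equalityI subsetI)
  fix xs assume xs: "xs \<in> lattice_paths p q"
  then obtain ys where "xs = p # ys" by (cases xs) (auto simp: lattice_paths_def)
  with xs show "xs \<in> (if p = q then {[p]} else {}) \<union> (Cons p ` lattice_paths (fst p, snd p + 1) q \<union>
      Cons p ` lattice_paths (fst p + 1, snd p + 1) q)"
    by (cases ys) (auto simp: lattice_paths_def lattice_edge_def)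
qed (auto simp: lattice_paths_def lattice_edge_def successively_Cons split: if_splits)

lemma card_lattice_paths:
  "finite (lattice_paths p q) \<and>
   card (lattice_paths p q) = lattice_count (fst q - fst p) (snd q - snd p)"
\<comment> \<open>The \<open>+ 1\<close> makes the base case the one where \<open>q\<close> lies
  strictly below \<open>p\<close>.\<close>
proof (induction "nat (snd q - snd p + 1)" arbitrary: p)
  case 0
  then have "lattice_paths p q = {}" using lattice_paths_mono(2)[of _ p q] by fastforce
  then show ?case using 0 by (simp add: lattice_count_def)
next
  case (Suc n)
  let ?A = "lattice_paths (fst p, snd p + 1) q" and ?B = "lattice_paths (fst p + 1, snd p + 1) q"
  let ?h = "snd q - snd p"
  have fin: "finite ?A" "finite ?B"
    and card: "card ?A = lattice_count (fst q - fst p) (?h - 1)"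
      "card ?B = lattice_count (fst q - fst p - 1) (?h - 1)"
    using Suc(1)[of "(fst p, snd p + 1)"] Suc(1)[of "(fst p + 1, snd p + 1)"] Suc(2)
    by (auto simp: algebra_simps)
  have disj: "?A \<inter> ?B = {}" "[] \<notin> ?A" "[] \<notin> ?B" by (auto simp: lattice_paths_def)
  have "card (Cons p ` ?A \<union> Cons p ` ?B) = card ?A + card ?B"
    using fin disj by (subst card_Un_disjoint) (auto simp: card_image)
  moreover have "card (lattice_paths p q) = (if p = q then 1 else 0) + card (Cons p ` ?A \<union> Cons p ` ?B)"
    using fin disj by (subst lattice_paths_rec, subst card_Un_disjoint) auto
  moreover have "p = q \<longleftrightarrow> fst q - fst p = 0 \<and> ?h = 0" by (auto simp: prod_eq_iff)
  moreover have "finite (lattice_paths p q)" using fin by (subst lattice_paths_rec) auto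
  ultimately show ?case
    using Suc(2) by (simp add: lattice_count_rec[of ?h] card)
qed

section \<open>The Lindstroem-Gessel-Viennot involution\<close>

definition paths_to :: "nat \<Rightarrow> (nat \<Rightarrow> nat) \<Rightarrow> nat \<Rightarrow> nat \<Rightarrow> point list set" where
  "paths_to d c l i = lattice_paths (source l) (sink d i (c i)) \<union>
     (if l = 2 * i \<and> c i = d then {[source l, sink d i d]} else {})"

definition path_systems :: "nat \<Rightarrow> (nat \<Rightarrow> nat) \<Rightarrow> ((nat \<Rightarrow> nat) \<times> (nat \<Rightarrow> point list)) set" where
  "path_systems d c = (SIGMA p : {p. p permutes {1..d-1}}. PiE {1..d-1} (\<lambda>l. paths_to d c l (p l)))"

text \<open>Special edges get no vertices, so they never take part in a crossing.\<close>

definition lattice_vertices :: "point list \<Rightarrow> point set" where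
  "lattice_vertices xs = (if successively lattice_edge xs then set xs else {})"

definition visitors :: "nat \<Rightarrow> (nat \<Rightarrow> point list) \<Rightarrow> point \<Rightarrow> nat set" where
  "visitors d G u = {l \<in> {1..d-1}. u \<in> lattice_vertices (G l)}"

definition crossings :: "nat \<Rightarrow> (nat \<Rightarrow> point list) \<Rightarrow> point set" where
  "crossings d G = {u. \<exists>a\<in>visitors d G u. \<exists>b\<in>visitors d G u. a \<noteq> b}"

text \<open>
  The choice depends on \<open>G\<close> only through \<open>visitors d G\<close> at the crossing points, which exchanging the
  tails of two paths at the chosen point does not change; hence the exchange is an involution.
\<close>

definition crossing_choice :: "nat \<Rightarrow> (nat \<Rightarrow> point list) \<Rightarrow> point \<times> nat \<times> nat" where
  "crossing_choice d G =
     (let v = (SOME v. v \<in> crossings d G)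
      in (v, SOME (a, b). a \<in> visitors d G v \<and> b \<in> visitors d G v \<and> a \<noteq> b))"

definition swap_tails ::
  "nat \<Rightarrow> (nat \<Rightarrow> nat) \<times> (nat \<Rightarrow> point list) \<Rightarrow> (nat \<Rightarrow> nat) \<times> (nat \<Rightarrow> point list)" where
  "swap_tails d = (\<lambda>(p, G). case crossing_choice d G of (v, a, b) \<Rightarrow>
     (p \<circ> transpose a b,
      G(a := swap_tail (snd v) (G a) (G b), b := swap_tail (snd v) (G b) (G a))))"

lemma crossing_choice:
  assumes "crossings d G \<noteq> {}" "crossing_choice d G = (v, a, b)"
  shows "a \<in> visitors d G v" "b \<in> visitors d G v" "a \<noteq> b"
proof -
  define w where "w = (SOME v. v \<in> crossings d G)"
  have "w \<in> crossings d G"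
    unfolding w_def using assms(1) by (simp add: some_in_eq)
  then have "\<exists>x. case x of (a, b) \<Rightarrow> a \<in> visitors d G w \<and> b \<in> visitors d G w \<and> a \<noteq> b"
    unfolding crossings_def by auto
  then have "case (SOME (a, b). a \<in> visitors d G w \<and> b \<in> visitors d G w \<and> a \<noteq> b) of
      (a, b) \<Rightarrow> a \<in> visitors d G w \<and> b \<in> visitors d G w \<and> a \<noteq> b"
    by (rule someI_ex)
  with assms(2) show "a \<in> visitors d G v" "b \<in> visitors d G v" "a \<noteq> b"
    by (auto simp: crossing_choice_def Let_def w_def[symmetric])
qed

text \<open>The special edge leads one step left and one step down.\<close>

lemma special_not_lattice: "\<not> lattice_edge (source (2 * i)) (sink d i d)"
proof (cases i)
  case (Suc m)
  then have "source (2 * i) = (int m + 2, - int m)" using source_even[of m] by simp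
  then show ?thesis by (simp add: Suc sink_def lattice_edge_def)
qed (simp add: sink_def lattice_edge_def source_def)

lemma paths_to_lattice:
  "xs \<in> paths_to d c l i \<Longrightarrow> successively lattice_edge xs \<Longrightarrow>
   xs \<in> lattice_paths (source l) (sink d i (c i))"
  using special_not_lattice[of i d] by (fastforce simp: paths_to_def split: if_splits)

text \<open>These properties make \<open>swap_tails\<close> a sign-reversing involution on the
  crossing systems.\<close>

lemma swap_tails_props:
  assumes pG: "(p, G) \<in> path_systems d c" and cr: "crossings d G \<noteq> {}"
    and ch: "crossing_choice d G = (v, a, b)" and sw: "swap_tails d (p, G) = (p', G')"
  shows "(p', G') \<in> path_systems d c" "crossings d G' = crossings d G"
    "crossing_choice d G' = (v, a, b)" "swap_tails d (p', G') = (p, G)" "sign p' = - sign p"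
proof -
  note vis = crossing_choice[OF cr ch]
  let ?I = "{1..d-1}"
  let ?t = "transpose a b"
  from pG have p: "p permutes ?I" and G: "G \<in> PiE ?I (\<lambda>l. paths_to d c l (p l))"
    by (auto simp: path_systems_def)
  from vis have abI: "a \<in> ?I" "b \<in> ?I" by (auto simp: visitors_def)
  have p': "p' = p \<circ> ?t"
    and G': "G' = G(a := swap_tail (snd v) (G a) (G b), b := swap_tail (snd v) (G b) (G a))"
    using sw ch by (auto simp: swap_tails_def)
  have va: "v \<in> set (G a)" "v \<in> set (G b)" "successively lattice_edge (G a)" "successively lattice_edge (G b)"
    using vis by (auto simp: visitors_def lattice_vertices_def split: if_splits)
  have lp: "G a \<in> lattice_paths (source a) (sink d (p a) (c (p a)))"
    "G b \<in> lattice_paths (source b) (sink d (p b) (c (p b)))"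
    using G abI va by (auto intro!: paths_to_lattice)
  have lp': "G' a \<in> lattice_paths (source a) (sink d (p b) (c (p b)))"
    "G' b \<in> lattice_paths (source b) (sink d (p a) (c (p a)))"
    using vis lp va by (auto simp: G' intro!: swap_tail_in_lattice_paths)
  have tI: "?t l \<in> ?I \<longleftrightarrow> l \<in> ?I" for l
    using abI by (auto simp: transpose_def)
  have "p' permutes ?I" unfolding p' using p abI by (intro permutes_compose permutes_swap_id)
  moreover have "G' \<in> PiE ?I (\<lambda>l. paths_to d c l (p' l))"
  proof (rule PiE_I)
    fix l assume "l \<in> ?I"
    then show "G' l \<in> paths_to d c l (p' l)"
      using lp' vis G by (cases "l = a \<or> l = b") (auto simp: paths_to_def p' G' transpose_def)
  qed (use G abI in \<open>auto simp: G' PiE_def extensional_def\<close>)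
  ultimately show mem: "(p', G') \<in> path_systems d c" by (simp add: path_systems_def)
  \<comment> \<open>Below the height of \<open>v\<close> all vertices stay; from there on those of
    paths \<open>a\<close> and \<open>b\<close> are exchanged.\<close>
  have verts: "u \<in> lattice_vertices (G' l) \<longleftrightarrow>
      u \<in> lattice_vertices (G (if snd u < snd v then l else ?t l))" for u l
  proof (cases "l = a \<or> l = b")
    case True
    have "successively lattice_edge (G' a)" "successively lattice_edge (G' b)"
      using lp' by (auto simp: lattice_paths_def)
    then show ?thesis using True va vis(3)
      by (auto simp: lattice_vertices_def G' set_swap_tail split: if_splits)
  qed (auto simp: G' transpose_def)
  have visit: "visitors d G' u = (if snd u < snd v then visitors d G u else {l. ?t l \<in> visitors d G u})"
    for u using tI by (auto simp: visitors_def verts simp del: atLeastAtMost_iff)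
  have tt: "?t (?t l) = l" for l by simp
  have t_inj: "?t l = ?t m \<longleftrightarrow> l = m" for l m by (metis tt)
  \<comment> \<open>Relabelling the visitors by a transposition preserves whether two distinct ones
    exist.\<close>
  show cr': "crossings d G' = crossings d G"
    unfolding crossings_def visit by (auto simp: t_inj) (metis tt)+
  \<comment> \<open>Both \<open>a\<close> and \<open>b\<close> visit \<open>v\<close>, so the
    transposition fixes this set and the same pair is chosen again.\<close>
  have "visitors d G' v = visitors d G v"
    using vis by (auto simp: visit transpose_def split: if_splits)
  then show ch': "crossing_choice d G' = (v, a, b)"
    using ch unfolding crossing_choice_def cr' Let_def by auto
  show "swap_tails d (p', G') = (p, G)"
  proof -
    have "p' \<circ> ?t = p" by (auto simp: p')
    moreover have "G'(a := swap_tail (snd v) (G' a) (G' b), b := swap_tail (snd v) (G' b) (G' a)) = G"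
      using vis(3) va by (auto simp: G' swap_tail_twice swap_tail_self)
    ultimately show ?thesis by (simp add: swap_tails_def ch')
  qed
  show "sign p' = - sign p"
    unfolding p' using p vis(3) permutes_imp_permutation[OF _ p]
    by (subst sign_compose) (auto simp: sign_swap_id permutation_swap_id)
qed

lemma finite_paths_to: "finite (paths_to d c l i)"
  by (simp add: paths_to_def card_lattice_paths)

lemma finite_path_systems: "finite (path_systems d c)"
  unfolding path_systems_def
  by (rule finite_SigmaI; (rule finite_permutations | rule finite_PiE); simp add: finite_paths_to)

text \<open>The involution shows that the sum is its own negative; signs are integers, so it is
  0.\<close>

lemma sum_crossing_path_systems:
  "(\<Sum>(p, G) | (p, G) \<in> path_systems d c \<and> crossings d G \<noteq> {}. sign p) = 0" (is "sum ?s ?A = 0")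
proof -
  have "sum ?s ?A = sum (\<lambda>x. - ?s x) ?A"
  proof (rule sum.reindex_bij_witness[where i = "swap_tails d" and j = "swap_tails d"])
    fix x assume "x \<in> ?A"
    then obtain p G where x: "x = (p, G)" "(p, G) \<in> path_systems d c" "crossings d G \<noteq> {}" by auto
    obtain v a b where ch: "crossing_choice d G = (v, a, b)" by (cases "crossing_choice d G") auto
    obtain p' G' where sw: "swap_tails d (p, G) = (p', G')" by (cases "swap_tails d (p, G)") auto
    note props = swap_tails_props[OF x(2,3) ch sw]
    show "swap_tails d (swap_tails d x) = x" "swap_tails d x \<in> ?A" "- ?s (swap_tails d x) = ?s x"
      using x props sw by auto
    then show "swap_tails d (swap_tails d x) = x" "swap_tails d x \<in> ?A" by auto
  qed
  then show ?thesis by (simp add: sum_negf)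
qed

section \<open>Noncrossing systems and the elements of \<open>VD\<close>\<close>

definition sink_index :: "nat \<Rightarrow> (nat \<Rightarrow> point list) \<Rightarrow> nat \<Rightarrow> nat" where
  "sink_index d G l = (if l \<in> {1..d-1} then nat (fst (last (G l))) else l)"

lemma last_paths_to: "xs \<in> paths_to d c l i \<Longrightarrow> last xs = sink d i (c i)"
  by (auto simp: paths_to_def lattice_paths_def split: if_splits)

lemma sink_index_path_system:
  assumes "(p, G) \<in> path_systems d c"
  shows "sink_index d G = p"
proof
  fix l
  from assms have "p permutes {1..d-1}" "\<And>l. l \<in> {1..d-1} \<Longrightarrow> G l \<in> paths_to d c l (p l)"
    by (auto simp: path_systems_def)
  then have "p permutes {1..d-1}" "l \<in> {1..d-1} \<Longrightarrow> last (G l) = sink d (p l) (c (p l))"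
    by (auto intro!: last_paths_to)
  then show "sink_index d G l = p l"
    by (auto simp: sink_index_def sink_def permutes_not_in)
qed

lemma paths_to_iff:
  assumes "i \<in> {1..d-1}"
  shows "xs \<in> paths_to d c l i \<longleftrightarrow>
    (lattice_path d c l xs \<or> special_path d c l xs) \<and> last xs = sink d i (c i)"
proof
  assume "xs \<in> paths_to d c l i"
  then show "(lattice_path d c l xs \<or> special_path d c l xs) \<and> last xs = sink d i (c i)"
    using assms
    by (auto simp: paths_to_def lattice_paths_def lattice_path_def special_path_def sinks_def
        split: if_splits)
next
  assume "(lattice_path d c l xs \<or> special_path d c l xs) \<and> last xs = sink d i (c i)"
  then show "xs \<in> paths_to d c l i"
    by (auto simp: paths_to_def lattice_paths_def lattice_path_def special_path_def sink_def)
qed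

lemma special_path_not_lattice: "special_path d c l xs \<Longrightarrow> \<not> successively lattice_edge xs"
  by (auto simp: special_path_def special_not_lattice)

lemma lattice_path_iff:
  assumes "lattice_path d c l xs \<or> special_path d c l xs"
  shows "lattice_path d c l xs \<longleftrightarrow> successively lattice_edge xs"
  using assms special_path_not_lattice[of d c l xs] by (auto simp: lattice_path_def)

lemma source_fst_snd:
  assumes "1 \<le> l"
  shows "1 \<le> fst (source l) + snd (source l)"
proof -
  obtain m where "l = Suc (2 * m) \<or> l = Suc (Suc (2 * m))"
    using assms by (metis One_nat_def Suc_le_D oddE evenE Suc_eq_plus1 even_Suc)
  then show ?thesis by (auto simp: source_odd source_even)
qed

text \<open>The coordinate sum is at least 1 at every source, increases along lattice edges, and is 0 at \<open>sink d i d\<close>.\<close>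

lemma no_lattice_path_to_special_sink:
  assumes "1 \<le> l" "lattice_path d c l xs" "c i = d"
  shows "last xs \<noteq> sink d i (c i)"
proof
  assume "last xs = sink d i (c i)"
  then have "xs \<in> lattice_paths (source l) (sink d i d)"
    using assms by (auto simp: lattice_path_def lattice_paths_def)
  from lattice_paths_mono[OF this] source_fst_snd[OF assms(1)] show False
    by (simp add: sink_def)
qed

text \<open>The point is that the paths of an element of \<open>VD\<close> end at distinct sinks:
  two lattice paths by disjointness, two special ones since \<open>l = 2 * i\<close>, and a mixed
  pair since no lattice path reaches a sink with \<open>c i = d\<close>. Hence
  \<open>sink_index\<close> is a permutation.\<close>

lemma path_systems_noncrossing_iff:
  "(p, G) \<in> path_systems d c \<and> crossings d G = {} \<longleftrightarrow> G \<in> VD d c \<and> p = sink_index d G"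
proof
  let ?I = "{1..d-1}"
  assume asm: "(p, G) \<in> path_systems d c \<and> crossings d G = {}"
  then have p: "p permutes ?I" and G: "G \<in> PiE ?I (\<lambda>l. paths_to d c l (p l))"
    by (auto simp: path_systems_def)
  have *: "lattice_path d c l (G l) \<or> special_path d c l (G l)" if "l \<in> ?I" for l
    using G that paths_to_iff[of "p l" d "G l" c l] permutes_in_image[OF p, of l] by blast
  have "set (G l) \<inter> set (G m) = {}"
    if "l \<in> ?I" "m \<in> ?I" "l \<noteq> m" "lattice_path d c l (G l)" "lattice_path d c m (G m)" for l m
  proof -
    have "u \<in> crossings d G" if "u \<in> set (G l)" "u \<in> set (G m)" for u
      using that \<open>l \<in> ?I\<close> \<open>m \<in> ?I\<close> \<open>l \<noteq> m\<close> \<open>lattice_path d c l (G l)\<close> \<open>lattice_path d c m (G m)\<close>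
      unfolding crossings_def visitors_def lattice_vertices_def lattice_path_def by auto
    with asm show ?thesis by auto
  qed
  with * G asm show "G \<in> VD d c \<and> p = sink_index d G"
    by (auto simp: VD_def PiE_def sink_index_path_system)
next
  let ?I = "{1..d-1}"
  assume asm: "G \<in> VD d c \<and> p = sink_index d G"
  then have ext: "G \<in> extensional ?I"
    and G: "\<And>l. l \<in> ?I \<Longrightarrow> lattice_path d c l (G l) \<or> special_path d c l (G l)"
    and disj: "\<And>l m. l \<in> ?I \<Longrightarrow> m \<in> ?I \<Longrightarrow> l \<noteq> m \<Longrightarrow> lattice_path d c l (G l) \<Longrightarrow>
      lattice_path d c m (G m) \<Longrightarrow> set (G l) \<inter> set (G m) = {}"
    by (auto simp: VD_def)
  have ends: "p l \<in> ?I \<and> last (G l) = sink d (p l) (c (p l))" if "l \<in> ?I" for l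
    using G[OF that] asm that
    by (auto simp: lattice_path_def special_path_def sinks_def sink_index_def sink_def)
  have inj: "inj_on p ?I"
  proof (rule inj_onI, rule ccontr)
    fix l m assume lm: "l \<in> ?I" "m \<in> ?I" "p l = p m" "l \<noteq> m"
    have last: "last (G l) = sink d (p l) (c (p l))" "last (G m) = sink d (p l) (c (p l))"
      using ends lm by metis+
    have spec: "k = 2 * p k \<and> c (p k) = d" if k: "k \<in> ?I" and sp: "special_path d c k (G k)" for k
    proof -
      obtain i where i: "k = 2 * i" "c i = d" "G k = [source k, sink d i d]"
        using sp unfolding special_path_def by blast
      have "last (G k) = sink d i d" unfolding i(3) by simp
      then have "fst (sink d (p k) (c (p k))) = fst (sink d i d)" using ends[OF k] by metis
      then have "p k = i" by (simp add: sink_def)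
      with i(1,2) show ?thesis by metis
    qed
    consider "lattice_path d c l (G l)" "lattice_path d c m (G m)"
      | "special_path d c l (G l)" "special_path d c m (G m)"
      | "lattice_path d c l (G l)" "special_path d c m (G m)"
      | "special_path d c l (G l)" "lattice_path d c m (G m)"
      using G lm by blast
    then show False
    proof cases
      case 1
      then have "last (G l) \<in> set (G l) \<inter> set (G m)"
        using last by (metis IntI last_in_set lattice_path_def)
      then show False using disj[OF lm(1,2,4) 1] by auto
    next
      case 2
      then show False using spec lm by metis
    next
      case 3
      then show False
        using spec[of m] lm last no_lattice_path_to_special_sink[of l d c "G l" "p l"]
        by (metis atLeastAtMost_iff)
    next
      case 4
      then show False
        using spec[of l] lm last no_lattice_path_to_special_sink[of m d c "G m" "p l"]
        by (metis atLeastAtMost_iff)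
    qed
  qed
  have "p permutes ?I"
  proof (rule bij_imp_permutes)
    have "p ` ?I \<subseteq> ?I" using ends by blast
    then show "bij_betw p ?I ?I"
      using inj endo_inj_surj[of ?I p] by (simp add: bij_betw_def)
  qed (use asm in \<open>auto simp: sink_index_def\<close>)
  moreover have "G \<in> PiE ?I (\<lambda>l. paths_to d c l (p l))"
  proof (rule PiE_I)
    fix l assume "l \<in> ?I"
    then show "G l \<in> paths_to d c l (p l)" using ends[of l] G[of l] by (simp add: paths_to_iff)
  qed (use ext in \<open>auto simp: extensional_def\<close>)
  moreover have "a = b" if "a \<in> visitors d G u" "b \<in> visitors d G u" for a b u
  proof (rule ccontr)
    assume "a \<noteq> b"
    have ab: "a \<in> ?I" "b \<in> ?I" "successively lattice_edge (G a)" "successively lattice_edge (G b)"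
      "u \<in> set (G a)" "u \<in> set (G b)"
      using that by (auto simp: visitors_def lattice_vertices_def split: if_splits)
    then show False
      using disj[OF ab(1,2) \<open>a \<noteq> b\<close>] lattice_path_iff[OF G[OF ab(1)]] lattice_path_iff[OF G[OF ab(2)]]
      by blast
  qed
  then have "crossings d G = {}" unfolding crossings_def by blast
  ultimately show "(p, G) \<in> path_systems d c \<and> crossings d G = {}"
    by (simp add: path_systems_def)
qed

lemma num_inv_eq:
  assumes "(p, G) \<in> path_systems d c"
  shows "num_inv d G = card (inversions {1..d-1} p)"
proof -
  have "last (G l) = sink d (p l) (c (p l))" if "l \<in> {1..d-1}" for l
    using assms that by (auto simp: path_systems_def intro!: last_paths_to)
  then show ?thesis
    unfolding num_inv_def inversions_def by (intro arg_cong[of _ _ card]) (auto simp: sink_def)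
qed

lemma sign_sink_index:
  assumes "G \<in> VD d c"
  shows "sign (sink_index d G) = (- 1) ^ num_inv d G"
proof -
  have "(sink_index d G, G) \<in> path_systems d c"
    using assms path_systems_noncrossing_iff[of "sink_index d G" G d c] by blast
  then show ?thesis
    by (auto simp: num_inv_eq path_systems_def intro!: sign_eq_inversions)
qed

text \<open>Crossing systems cancel, so the sum may run over all systems; for a fixed permutation
  the paths are then chosen independently.\<close>

lemma sum_VD:
  "(\<Sum>G\<in>VD d c. (- 1) ^ num_inv d G) =
   (\<Sum>p | p permutes {1..d-1}. sign p * (\<Prod>l\<in>{1..d-1}. int (card (paths_to d c l (p l)))))"
proof -
  let ?N = "{(p, G). (p, G) \<in> path_systems d c \<and> crossings d G = {}}"
  let ?C = "{(p, G). (p, G) \<in> path_systems d c \<and> crossings d G \<noteq> {}}"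
  have "(\<Sum>G\<in>VD d c. (- 1) ^ num_inv d G) = (\<Sum>(p, G)\<in>?N. sign p)"
    by (rule sum.reindex_bij_witness[where i = snd and j = "\<lambda>G. (sink_index d G, G)"])
       (auto simp: path_systems_noncrossing_iff sign_sink_index)
  also have "\<dots> = (\<Sum>(p, G)\<in>?N. sign p) + (\<Sum>(p, G)\<in>?C. sign p)"
    by (simp add: sum_crossing_path_systems)
  also have "\<dots> = (\<Sum>(p, G)\<in>?N \<union> ?C. sign p)"
    by (rule sum.union_disjoint[symmetric]) (auto intro: finite_subset[OF _ finite_path_systems])
  also have "?N \<union> ?C = path_systems d c" by auto
  also have "(\<Sum>(p, G)\<in>path_systems d c. sign p) =
      (\<Sum>p | p permutes {1..d-1}. \<Sum>G\<in>PiE {1..d-1} (\<lambda>l. paths_to d c l (p l)). sign p)"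
    unfolding path_systems_def
    by (rule sum.Sigma[symmetric]) (auto simp: finite_permutations finite_paths_to intro!: finite_PiE)
  finally show ?thesis by (simp add: card_PiE mult.commute)
qed

section \<open>Path counts and elementary symmetric polynomials\<close>

text \<open>For \<open>f = x^n\<close> the recursion is Pascal's rule. The extra 1 at
  \<open>n = 0\<close> comes from \<open>P = 1\<close> and will be matched by the special
  edge.\<close>

lemma stair_0_even_odd:
  "stair (\<lambda>_. 0) n (2 * m) k =
     (of_nat (lattice_count (int k - int m) (int n - int k - 1 + int m)) :: 'a::comm_ring_1)"
  "stair (\<lambda>_. 0) n (Suc (2 * m)) k =
     (of_nat (lattice_count (int k - int m - 1) (int n - int k - 1 + int m) +
       (if k = m \<and> n = 0 then 1 else 0)) :: 'a::comm_ring_1)"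
proof (induction n arbitrary: m)
  case 0
  { case 1 then show ?case by (auto simp: lattice_count_def) }
  { case 2 then show ?case by (auto simp: lattice_count_def) }
next
  case (Suc n)
  {
    case 1
    define h where "h = int n - int k - 1 + int m"
    \<comment> \<open>For \<open>k = m\<close> one has \<open>h + 1 = n\<close>, so the initial term
      of Pascal's rule is the extra term of the odd case.\<close>
    have "lattice_count (int k - int m) (h + 1) = (if k = m \<and> n = 0 then 1 else 0) +
        lattice_count (int k - int m) h + lattice_count (int k - int m - 1) h"
    proof (cases "k \<le> n + m")
      case True
      then have "0 \<le> h + 1" "int k - int m = 0 \<and> h + 1 = 0 \<longleftrightarrow> k = m \<and> n = 0"
        by (auto simp: h_def)
      then show ?thesis by (simp only: lattice_count_rec[of "h + 1"]) simp
    next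
      case False
      then show ?thesis by (auto simp: lattice_count_def h_def)
    qed
    moreover have "int (Suc n) - int k - 1 + int m = h + 1" by (simp add: h_def)
    moreover have "stair (\<lambda>_. 0) (Suc n) (2 * m) k =
        (stair (\<lambda>_. 0) n (Suc (2 * m)) k + stair (\<lambda>_. 0) n (2 * m) k :: 'a)" by simp
    ultimately show ?case unfolding Suc.IH h_def[symmetric] by simp
  next
    case 2
    \<comment> \<open>At an odd index the recursion keeps only its first term, which is the even
      case for \<open>Suc m\<close>.\<close>
    show ?case
      using Suc.IH(1)[of "Suc m"] by (simp add: algebra_simps)
  }
qed

text \<open>The displacement from source to sink gives the arguments of
  \<open>lattice_count\<close>, and the special edge the extra term. Sources and sinks count from 1,
  matrix indices from 0.\<close>

lemma card_paths_to:
  assumes "c (Suc k) \<le> d"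
  shows "(of_nat (card (paths_to d c (Suc j) (Suc k))) :: 'a::comm_ring_1) =
    stair (\<lambda>_. 0) (d - c (Suc k)) j k"
proof -
  let ?L = "lattice_paths (source (Suc j)) (sink d (Suc k) (c (Suc k)))"
  have "card (paths_to d c (Suc j) (Suc k)) =
      card ?L + (if Suc j = 2 * Suc k \<and> c (Suc k) = d then 1 else 0)"
  proof (cases "Suc j = 2 * Suc k \<and> c (Suc k) = d")
    case True
    then have "[source (Suc j), sink d (Suc k) d] \<notin> ?L"
      using special_not_lattice[of "Suc k" d] by (auto simp: lattice_paths_def)
    then show ?thesis using True by (simp add: paths_to_def card_lattice_paths)
  qed (auto simp: paths_to_def)
  moreover obtain m where "j = 2 * m \<or> j = Suc (2 * m)"
    by (metis evenE oddE Suc_eq_plus1)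
  then have "of_nat (card ?L + (if Suc j = 2 * Suc k \<and> c (Suc k) = d then 1 else 0)) =
      (stair (\<lambda>_. 0) (d - c (Suc k)) j k :: 'a)"
  proof
    assume j: "j = 2 * m"
    have "card ?L = lattice_count (int k - int m) (int (d - c (Suc k)) - int k - 1 + int m)"
      unfolding card_lattice_paths[THEN conjunct2] j source_odd sink_def
      using assms by (intro arg_cong2[of _ _ _ _ lattice_count]) auto
    moreover have "Suc j \<noteq> 2 * Suc k" using j by presburger
    ultimately show ?thesis by (simp only: j stair_0_even_odd(1)) simp
  next
    assume j: "j = Suc (2 * m)"
    have "card ?L = lattice_count (int k - int m - 1) (int (d - c (Suc k)) - int k - 1 + int m)"
      unfolding card_lattice_paths[THEN conjunct2] j source_even sink_def
      using assms by (intro arg_cong2[of _ _ _ _ lattice_count]) auto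
    moreover have "Suc j = 2 * Suc k \<and> c (Suc k) = d \<longleftrightarrow> k = m \<and> d - c (Suc k) = 0"
      using assms j by auto
    ultimately show ?thesis by (simp only: j stair_0_even_odd(2))
  qed
  ultimately show ?thesis by simp
qed

section \<open>Expansion in elementary symmetric polynomials\<close>

lemma elem_sym_0: "elem_sym d 0 z = 1"
proof -
  have "{S. S \<subseteq> {1..d} \<and> card S = 0} = {{}}"
    using finite_subset[of _ "{1..d}"] by auto
  then show ?thesis unfolding elem_sym_def by simp
qed

lemma elem_sym_eq_0:
  assumes "d < k"
  shows "elem_sym d k z = 0"
proof -
  have "card S \<le> d" if "S \<subseteq> {1..d}" for S
    using card_mono[OF _ that] by simp
  then have "{S. S \<subseteq> {1..d} \<and> card S = k} = {}"
    using assms by (metis (mono_tags, lifting) Collect_empty_eq leD)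
  then show ?thesis unfolding elem_sym_def by (simp only: sum.empty)
qed

text \<open>The subsets are split by whether they contain \<open>Suc d\<close>.\<close>

lemma elem_sym_Suc_Suc:
  "elem_sym (Suc d) (Suc k) z = elem_sym d (Suc k) z + z (Suc d) * elem_sym d k z"
proof -
  let ?F = "\<lambda>d k. {S. S \<subseteq> {1..d} \<and> card S = k}"
  have fin: "finite (?F d k)" for d k :: nat
    by (rule finite_subset[of _ "Pow {1..d}"]) auto
  have new: "Suc d \<notin> S" "finite S" if "S \<in> ?F d k" for S k
    using that finite_subset[of S "{1..d}"] by auto
  have ins: "{Suc 0..Suc d} = insert (Suc d) {Suc 0..d}" by auto
  have "?F (Suc d) (Suc k) = ?F d (Suc k) \<union> insert (Suc d) ` ?F d k" (is "?L = ?R")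
  proof (intro equalityI subsetI)
    fix S assume S: "S \<in> ?L"
    show "S \<in> ?R"
    proof (cases "Suc d \<in> S")
      case True
      then have "S - {Suc d} \<in> ?F d k"
        using S by (simp add: ins subset_insert_iff)
      moreover have "S = insert (Suc d) (S - {Suc d})" using True by auto
      ultimately show ?thesis by blast
    next
      case False
      then show ?thesis using S by (simp add: ins subset_insert)
    qed
  next
    fix S assume "S \<in> ?R"
    then show "S \<in> ?L"
    proof
      assume "S \<in> insert (Suc d) ` ?F d k"
      then obtain T where "S = insert (Suc d) T" "T \<in> ?F d k" by blast
      with new[of T k] show ?thesis by (simp add: ins subset_insertI2)
    qed (simp add: ins subset_insertI2)
  qed
  then have "elem_sym (Suc d) (Suc k) z = (\<Sum>S\<in>?F d (Suc k) \<union> insert (Suc d) ` ?F d k. \<Prod>i\<in>S. z i)"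
    by (simp only: elem_sym_def)
  also have "\<dots> = (\<Sum>S\<in>?F d (Suc k). \<Prod>i\<in>S. z i) + (\<Sum>S\<in>insert (Suc d) ` ?F d k. \<Prod>i\<in>S. z i)"
  proof (rule sum.union_disjoint)
    show "?F d (Suc k) \<inter> insert (Suc d) ` ?F d k = {}"
      using new(1)[of _ "Suc k"] by blast
  qed (simp_all only: fin finite_imageI)
  also have "(\<Sum>S\<in>insert (Suc d) ` ?F d k. \<Prod>i\<in>S. z i) = (\<Sum>S\<in>?F d k. \<Prod>i\<in>insert (Suc d) S. z i)"
  proof (rule sum.reindex[unfolded comp_def])
    show "inj_on (insert (Suc d)) (?F d k)"
      using new by (intro inj_onI) (metis insert_ident)
  qed
  also have "\<dots> = z (Suc d) * elem_sym d k z"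
    unfolding elem_sym_def sum_distrib_left
  proof (rule sum.cong[OF refl])
    fix S assume "S \<in> ?F d k"
    from new[OF this] show "(\<Prod>i\<in>insert (Suc d) S. z i) = z (Suc d) * (\<Prod>i\<in>S. z i)" by simp
  qed
  finally show ?thesis by (simp add: elem_sym_def)
qed

text \<open>The entries are linear in \<open>f\<close>, and \<open>f\<close> is the sum of the terms
  \<open>e_r x^(d - r)\<close>; zero parameters give the power of \<open>x\<close>.\<close>

lemma stair_eq_sum_elem_sym:
  "stair z d j k = (\<Sum>r\<le>d. elem_sym d r z * stair (\<lambda>_. 0) (d - r) j k)"
proof (induction d arbitrary: j)
  case 0
  then show ?case by (simp add: elem_sym_0)
next
  case (Suc d)
  let ?C = "\<lambda>n j. stair (\<lambda>_. 0) n j k"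
  have "(\<Sum>r\<le>Suc d. elem_sym (Suc d) r z * ?C (Suc d - r) j) =
      ?C (Suc d) j + (\<Sum>r\<le>d. elem_sym (Suc d) (Suc r) z * ?C (d - r) j)"
    by (subst sum.atMost_Suc_shift) (simp add: elem_sym_0 del: stair.simps)
  also have "\<dots> = (?C (Suc d) j + (\<Sum>r\<le>d. elem_sym d (Suc r) z * ?C (Suc d - Suc r) j)) +
      z (Suc d) * (\<Sum>r\<le>d. elem_sym d r z * ?C (d - r) j)"
    by (simp add: elem_sym_Suc_Suc algebra_simps sum.distrib sum_distrib_left del: stair.simps)
  also have "?C (Suc d) j + (\<Sum>r\<le>d. elem_sym d (Suc r) z * ?C (Suc d - Suc r) j) =
      (\<Sum>r\<le>Suc d. elem_sym d r z * ?C (Suc d - r) j)"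
    by (subst sum.atMost_Suc_shift) (simp add: elem_sym_0 del: stair.simps)
  \<comment> \<open>The summand \<open>r = Suc d\<close> drops out, since
    \<open>elem_sym d (Suc d) z = 0\<close>.\<close>
  also have "\<dots> = (\<Sum>r\<le>d. elem_sym d r z * ?C (Suc (d - r)) j)"
    by (simp add: elem_sym_eq_0 Suc_diff_le del: stair.simps)
  also have "\<dots> = (\<Sum>r\<le>d. elem_sym d r z * ?C (d - r) (Suc j)) +
      (if even j then 1 else 0) * (\<Sum>r\<le>d. elem_sym d r z * ?C (d - r) j)"
    by (auto simp: algebra_simps sum.distrib sum_distrib_left)
  finally show ?case by (simp add: Suc.IH[symmetric] algebra_simps)
qed

section \<open>Generating functions\<close>

text \<open>Each pair \<open>i < j\<close> independently carries no edge, the edge from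
  \<open>j\<close> or the edge from \<open>i\<close>; expanding the product makes one choice per
  pair.\<close>

lemma sum_weight_DSG:
  fixes z :: "nat \<Rightarrow> 'a::comm_ring_1"
  shows "(\<Sum>E\<in>DSG d. weight z E) = (\<Prod>j=1..d. \<Prod>i=1..<j. 1 + z j + z i)"
proof -
  define P where "P = (SIGMA j:{1..d}. {1..<j})"
  define B where "B x = {{}, {x}, {prod.swap x}}" for x :: "nat \<times> nat"
  have P: "finite P" by (simp add: P_def)
  have "(\<Prod>j=1..d. \<Prod>i=1..<j. 1 + z j + z i) = (\<Prod>(j, i)\<in>P. 1 + z j + z i)"
    unfolding P_def by (rule prod.Sigma) auto
  also have "\<dots> = (\<Prod>x\<in>P. \<Sum>S\<in>B x. weight z S)"
    by (rule prod.cong) (auto simp: P_def B_def weight_def)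
  also have "\<dots> = (\<Sum>g\<in>PiE P B. \<Prod>x\<in>P. weight z (g x))"
    by (rule prod_sum_PiE) (auto simp: P B_def)
  also have "\<dots> = (\<Sum>E\<in>DSG d. weight z E)"
  proof (rule sum.reindex_bij_witness[where j = "\<lambda>g. \<Union>x\<in>P. g x"
        and i = "\<lambda>E. \<lambda>x\<in>P. E \<inter> {x, prod.swap x}"])
    fix g assume g: "g \<in> PiE P B"
    then have gx: "g x \<subseteq> {x, prod.swap x}" "g x \<in> B x" if "x \<in> P" for x
      using that by (auto simp: B_def dest!: PiE_mem)
    \<comment> \<open>Different pairs have no possible edge in common, so \<open>g\<close> can be
      recovered from the union.\<close>
    have sep: "x = y" if "x \<in> P" "y \<in> P" "{x, prod.swap x} \<inter> {y, prod.swap y} \<noteq> {}" for x y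
      using that by (auto simp: P_def)
    have restr: "(\<Union>y\<in>P. g y) \<inter> {x, prod.swap x} = g x" if "x \<in> P" for x
      using gx sep that by blast
    show "(\<lambda>x\<in>P. (\<Union>x\<in>P. g x) \<inter> {x, prod.swap x}) = g"
    proof
      fix x
      show "(\<lambda>x\<in>P. (\<Union>x\<in>P. g x) \<inter> {x, prod.swap x}) x = g x"
        by (cases "x \<in> P") (simp_all add: restr PiE_arb[OF g])
    qed
    show "(\<Union>x\<in>P. g x) \<in> DSG d"
    proof -
      have "(\<Union>x\<in>P. g x) \<subseteq> {1..d} \<times> {1..d}"
        using gx(1) by (fastforce simp: P_def)
      moreover have "(i, i) \<notin> (\<Union>x\<in>P. g x)" for i
        using gx(1) by (fastforce simp: P_def)
      moreover have "(j, i) \<notin> (\<Union>x\<in>P. g x)" if "(i, j) \<in> (\<Union>x\<in>P. g x)" for i j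
      proof
        assume ji: "(j, i) \<in> (\<Union>x\<in>P. g x)"
        from that obtain x where x: "x \<in> P" "(i, j) \<in> g x" by auto
        then have "x = (i, j) \<or> x = (j, i)" using gx(1)[of x] by (cases x) auto
        then have "(j, i) \<in> {x, prod.swap x}" by auto
        with ji have "(j, i) \<in> g x" by (subst restr[OF x(1), symmetric]) (rule IntI)
        moreover have "(i, j) \<noteq> (j, i)" using x gx(1)[of x] by (auto simp: P_def)
        ultimately show False using x gx(2)[of x] by (cases x) (auto simp: B_def)
      qed
      ultimately show ?thesis by (auto simp: DSG_def)
    qed
    have "weight z (\<Union>x\<in>P. g x) = (\<Prod>x\<in>P. weight z (g x))"
      unfolding weight_def
    proof (rule prod.UNION_disjoint)
      show "\<forall>x\<in>P. finite (g x)" using gx(1) by (meson finite.emptyI finite.insertI finite_subset)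
      show "\<forall>x\<in>P. \<forall>y\<in>P. x \<noteq> y \<longrightarrow> g x \<inter> g y = {}" using gx(1) sep by blast
    qed (rule P)
    then show "weight z (\<Union>x\<in>P. g x) = (\<Prod>x\<in>P. weight z (g x))" .
  next
    fix E assume E: "E \<in> DSG d"
    show "(\<lambda>x\<in>P. E \<inter> {x, prod.swap x}) \<in> PiE P B"
      using E by (auto simp: B_def DSG_def)
    have "e \<in> (\<Union>x\<in>P. E \<inter> {x, prod.swap x})" if "e \<in> E" for e
    proof -
      obtain a b where e: "e = (a, b)" by (cases e)
      have "a \<noteq> b" "a \<in> {1..d}" "b \<in> {1..d}" using E that by (auto simp: DSG_def e)
      then have "(a, b) \<in> P \<or> (b, a) \<in> P" by (auto simp: P_def)
      then show ?thesis
        using that by (auto simp: e intro: bexI[of _ "(a, b)"] bexI[of _ "(b, a)"])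
    qed
    then show "(\<Union>x\<in>P. (\<lambda>x\<in>P. E \<inter> {x, prod.swap x}) x) = E" by auto
  qed
  finally show ?thesis ..
qed

section \<open>Marking degrees by a polynomial variable, and the final expansion\<close>

lemma prod_monom: "(\<Prod>x\<in>A. monom (f x) (g x)) = monom (\<Prod>x\<in>A. f x) (\<Sum>x\<in>A. g x)"
  by (induction A rule: infinite_finite_induct) (simp_all add: mult_monom)

text \<open>Every edge contributes one power of the variable, so the degree counts edges.\<close>

lemma weight_monom: "weight (\<lambda>i. monom (z i) 1) E = monom (weight z E) (card E)"
  using prod_monom[of "\<lambda>(i, j). z i" "\<lambda>_. 1" E] by (simp add: weight_def case_prod_beta)

lemma elem_sym_monom: "elem_sym d r (\<lambda>i. monom (z i) 1) = monom (elem_sym d r z) r"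
  unfolding elem_sym_def monom_sum by (intro sum.cong refl) (simp add: prod_monom)

text \<open>Conjugation by \<open>Suc\<close> moves permutations to the index set of sources and
  sinks and preserves the sign.\<close>

lemma det_permutes_atLeast1:
  "det (mat n n (\<lambda>(i, j). f i j)) =
   (\<Sum>p | p permutes {1..n}. of_int (sign p) * (\<Prod>l=1..n. f (l - 1) (p l - 1)))"
proof -
  have bij: "bij_betw Suc {0..<n} {1..n}"
    by (auto simp: bij_betw_def atLeastLessThanSuc_atLeastAtMost)
  then have bij': "bij_betw (\<lambda>x. x - 1) {1..n} {0..<n}"
    by (intro bij_betw_byWitness[where f' = Suc]) auto
  let ?u = "map_permutation {0..<n} Suc" and ?v = "map_permutation {1..n} (\<lambda>x. x - 1)"
  have "det (mat n n (\<lambda>(i, j). f i j)) =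
      (\<Sum>p | p permutes {0..<n}. of_int (sign p) * (\<Prod>i = 0..<n. f i (p i)))"
    by (subst det_def'[of _ n])
       (auto intro!: sum.cong prod.cong arg_cong2[of _ _ _ _ "(*)"] dest: permutes_in_image)
  also have "\<dots> = (\<Sum>p | p permutes {1..n}. of_int (sign p) * (\<Prod>l=1..n. f (l - 1) (p l - 1)))"
  proof (rule sum.reindex_bij_witness[where j = ?u and i = ?v]; clarsimp simp del: One_nat_def)
    fix p assume p: "p permutes {0..<n}"
    show "?v (?u p) = p"
      using map_permutation_compose_inv[OF bij p] by simp
    show "?u p permutes {1..n}" by (rule map_permutation_permutes[OF bij p])
    have "(\<Prod>l=1..n. f (l - 1) (?u p l - 1)) = (\<Prod>i = 0..<n. f i (p i))"
      by (rule prod.reindex_bij_betw[OF bij, symmetric, THEN trans])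
         (auto simp: map_permutation_apply intro!: prod.cong)
    then show "of_int (sign (?u p)) * (\<Prod>l=1..n. f (l - 1) (?u p l - 1)) =
        of_int (sign p) * (\<Prod>i = 0..<n. f i (p i))"
      using p bij by (simp add: sign_map_permutation)
  next
    fix p assume p: "p permutes {1..n}"
    show "?u (?v p) = p"
      using map_permutation_compose_inv[OF bij' p] by simp
    show "?v p permutes {0..<n}" by (rule map_permutation_permutes[OF bij' p])
  qed
  finally show ?thesis .
qed

text \<open>This is multilinearity in the columns: \<open>c i\<close> is the summand chosen in
  column \<open>i\<close>.\<close>

lemma prod_stair_expand:
  fixes z :: "nat \<Rightarrow> 'a::comm_ring_1"
  assumes p: "p permutes {1..n}"
  shows "(\<Prod>l=1..n. stair z (Suc n) (l - 1) (p l - 1)) =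
    (\<Sum>c\<in>PiE {1..n} (\<lambda>_. {..Suc n}). (\<Prod>i=1..n. elem_sym (Suc n) (c i) z) *
      of_nat (\<Prod>l=1..n. card (paths_to (Suc n) c l (p l))))"
proof -
  let ?I = "{1..n}" and ?d = "Suc n"
  \<comment> \<open>As \<open>c\<close> is indexed by sinks, the product over sources
    \<open>l\<close> is rewritten over \<open>i = p l\<close> before it is expanded.\<close>
  define q where "q = Hilbert_Choice.inv p"
  have q: "q permutes ?I" "\<And>l. q (p l) = l"
    using p permutes_inv[OF p] permutes_inverses[OF p] by (auto simp: q_def)
  have reindex: "(\<Prod>i\<in>?I. h (q i) i) = (\<Prod>l\<in>?I. h l (p l))" for h :: "nat \<Rightarrow> nat \<Rightarrow> 'a"
    by (subst prod.permute[OF p]) (simp add: q)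
  have card_eq: "of_nat (card (paths_to ?d c l (p l))) =
      (stair (\<lambda>_. 0) (?d - c (p l)) (l - 1) (p l - 1) :: 'a)"
    if "c \<in> PiE ?I (\<lambda>_. {..?d})" "l \<in> ?I" for c l
  proof -
    have "p l \<in> ?I" using that p by (simp only: permutes_in_image)
    moreover from this that have "c (p l) \<le> ?d" by (auto dest: PiE_mem)
    ultimately show ?thesis
      using card_paths_to[of c "p l - 1" ?d "l - 1", where 'a = 'a] that by simp
  qed
  have "(\<Prod>l\<in>?I. stair z ?d (l - 1) (p l - 1)) = (\<Prod>i\<in>?I. stair z ?d (q i - 1) (i - 1))"
    by (rule reindex[symmetric])
  also have "\<dots> = (\<Prod>i\<in>?I. \<Sum>r\<le>?d. elem_sym ?d r z * stair (\<lambda>_. 0) (?d - r) (q i - 1) (i - 1))"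
    by (simp only: stair_eq_sum_elem_sym[of z])
  also have "\<dots> = (\<Sum>c\<in>PiE ?I (\<lambda>_. {..?d}). \<Prod>i\<in>?I.
      elem_sym ?d (c i) z * stair (\<lambda>_. 0) (?d - c i) (q i - 1) (i - 1))"
    by (rule prod_sum_PiE) auto
  also have "\<dots> = (\<Sum>c\<in>PiE ?I (\<lambda>_. {..?d}). (\<Prod>i\<in>?I. elem_sym ?d (c i) z) *
      (\<Prod>l\<in>?I. stair (\<lambda>_. 0) (?d - c (p l)) (l - 1) (p l - 1)))"
    unfolding prod.distrib
    by (intro sum.cong refl arg_cong2[of _ _ _ _ "(*)"]) (rule reindex)
  also have "\<dots> = (\<Sum>c\<in>PiE ?I (\<lambda>_. {..?d}). (\<Prod>i\<in>?I. elem_sym ?d (c i) z) *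
      of_nat (\<Prod>l\<in>?I. card (paths_to ?d c l (p l))))"
    unfolding of_nat_prod
    by (intro sum.cong refl arg_cong2[of _ _ _ _ "(*)"] prod.cong) (simp only: card_eq)
  finally show ?thesis .
qed

text \<open>Exchanging the sums over permutations and over \<open>c\<close> leaves, for each
  \<open>c\<close>, the signed count in \<open>sum_VD\<close>.\<close>

lemma det_stair_mat_eq_sum_VD:
  fixes z :: "nat \<Rightarrow> 'a::comm_ring_1"
  shows "det (stair_mat z n) =
    (\<Sum>c\<in>PiE {1..n} (\<lambda>_. {..Suc n}). elem_sym_comp (Suc n) c z *
      of_int (\<Sum>G\<in>VD (Suc n) c. (- 1) ^ num_inv (Suc n) G))"
proof -
  let ?I = "{1..n}" and ?d = "Suc n"
  have "det (stair_mat z n) =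
      (\<Sum>p | p permutes ?I. of_int (sign p) * (\<Prod>l=1..n. stair z ?d (l - 1) (p l - 1)))"
    unfolding stair_mat_def by (rule det_permutes_atLeast1[of n "stair z ?d"])
  also have "\<dots> = (\<Sum>p | p permutes ?I. of_int (sign p) *
      (\<Sum>c\<in>PiE ?I (\<lambda>_. {..?d}). elem_sym_comp ?d c z *
        of_nat (\<Prod>l=1..n. card (paths_to ?d c l (p l)))))"
    by (intro sum.cong refl) (simp only: mem_Collect_eq prod_stair_expand elem_sym_comp_def diff_Suc_1)
  also have "\<dots> = (\<Sum>c\<in>PiE ?I (\<lambda>_. {..?d}). elem_sym_comp ?d c z *
      of_int (\<Sum>p | p permutes ?I. sign p * (\<Prod>l\<in>?I. int (card (paths_to ?d c l (p l))))))"
    unfolding sum_distrib_left by (subst sum.swap) (simp add: sum_distrib_left mult_ac)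
  also have "\<dots> = (\<Sum>c\<in>PiE ?I (\<lambda>_. {..?d}). elem_sym_comp ?d c z *
      of_int (\<Sum>G\<in>VD ?d c. (- 1) ^ num_inv ?d G))"
    using sum_VD[of ?d] by (simp only: diff_Suc_1)
  finally show ?thesis .
qed

text \<open>Both sides are the coefficient of degree \<open>l\<close> in
  \<open>det (stair_mat Z n)\<close>, where \<open>Z\<close> carries the marked variables.\<close>

lemma sum_weight_DSG_card:
  fixes z :: "nat \<Rightarrow> 'a::comm_ring_1"
  shows "(\<Sum>E | E \<in> DSG (Suc n) \<and> card E = l. weight z E) =
    (\<Sum>c\<in>compositions l n. elem_sym_comp (Suc n) c z * (\<Sum>G\<in>VD (Suc n) c. (- 1) ^ num_inv (Suc n) G))"
proof -
  let ?d = "Suc n"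
  define Z where "Z = (\<lambda>i. monom (z i) 1)"
  define V :: "(nat \<Rightarrow> nat) \<Rightarrow> int" where "V c = (\<Sum>G\<in>VD ?d c. (- 1) ^ num_inv ?d G)" for c
  have fin: "finite (DSG ?d)"
    by (rule finite_subset[of _ "Pow ({1..?d} \<times> {1..?d})"]) (auto simp: DSG_def)
  have "(\<Sum>E | E \<in> DSG ?d \<and> card E = l. weight z E) = coeff (\<Sum>E\<in>DSG ?d. weight Z E) l"
    using fin by (simp add: Z_def weight_monom[simplified] coeff_sum sum.If_cases Int_def)
  also have "(\<Sum>E\<in>DSG ?d. weight Z E) = det (stair_mat Z n)"
    unfolding sum_weight_DSG det_stair_mat ..
  also have "\<dots> = (\<Sum>c\<in>PiE {1..n} (\<lambda>_. {..?d}). elem_sym_comp ?d c Z * of_int (V c))"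
    unfolding V_def by (rule det_stair_mat_eq_sum_VD)
  also have "\<dots> = (\<Sum>c\<in>PiE {1..n} (\<lambda>_. {..?d}).
      monom (elem_sym_comp ?d c z * of_int (V c)) (\<Sum>i=1..n. c i))"
    unfolding Z_def elem_sym_comp_def elem_sym_monom prod_monom of_int_monom mult_monom by simp
  also have "coeff \<dots> l = (\<Sum>c\<in>{c \<in> PiE {1..n} (\<lambda>_. {..?d}). (\<Sum>i=1..n. c i) = l}.
      elem_sym_comp ?d c z * of_int (V c))"
    by (simp add: coeff_sum sum.If_cases finite_PiE Int_def)
  \<comment> \<open>The expansion only has parts up to \<open>Suc n\<close>; a composition with a
    larger part contributes 0 by \<open>elem_sym_eq_0\<close>.\<close>
  also have "\<dots> = (\<Sum>c\<in>compositions l n. elem_sym_comp ?d c z * of_int (V c))"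
  proof (rule sum.mono_neutral_left)
    have "c \<in> PiE {1..n} (\<lambda>_. {..l})" if "c \<in> compositions l n" for c
    proof (rule PiE_I)
      fix i assume "i \<in> {1..n}"
      then show "c i \<in> {..l}"
        using that member_le_sum[of i "{1..n}" c] by (simp add: compositions_def)
    qed (use that in \<open>auto simp: compositions_def PiE_def extensional_def\<close>)
    then have "compositions l n \<subseteq> PiE {1..n} (\<lambda>_. {..l})" by (rule subsetI)
    then show "finite (compositions l n)"
      by (rule finite_subset) (auto intro!: finite_PiE)
    show "{c \<in> PiE {1..n} (\<lambda>_. {..?d}). (\<Sum>i=1..n. c i) = l} \<subseteq> compositions l n"
      by (auto simp: compositions_def PiE_def)
    show "\<forall>c\<in>compositions l n - {c \<in> PiE {1..n} (\<lambda>_. {..?d}). (\<Sum>i=1..n. c i) = l}.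
        elem_sym_comp ?d c z * of_int (V c) = 0"
    proof
      fix c assume c: "c \<in> compositions l n - {c \<in> PiE {1..n} (\<lambda>_. {..?d}). (\<Sum>i=1..n. c i) = l}"
      then obtain i where "i \<in> {1..n}" "?d < c i"
        by (auto simp: compositions_def PiE_def Pi_def)
      then have "elem_sym_comp ?d c z = 0"
        unfolding elem_sym_comp_def by (intro prod_zero) (auto simp: elem_sym_eq_0 intro!: bexI[of _ i])
      then show "elem_sym_comp ?d c z * of_int (V c) = 0" by simp
    qed
  qed
  finally show ?thesis by (simp add: V_def)
qed

theorem theorem4:
  fixes d l :: nat and z :: "nat \<Rightarrow> 'a::comm_ring_1 mpoly"
  assumes "d \<ge> 2" and "z = indet"
  shows "(\<Sum>\<G> | \<G> \<in> DSG d \<and> card \<G> = l. weight z \<G>) =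
         (\<Sum>c\<in>compositions l (d - 1).
            elem_sym_comp d c z * (\<Sum>G\<in>VD d c. (- 1) ^ num_inv d G))"
proof -
  have "Suc (d - 1) = d" using assms(1) by simp
  from sum_weight_DSG_card[where n = "d - 1" and l = l and z = z, unfolded this] show ?thesis .
qed

end
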